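(* Let $(S,\cdot)$ be a semigroup for which the minimal left ideals of $\beta S$ are singletons. Define $s\prec t$ iff $st=t$, and $s\preceq t$ iff $s\prec t$ or $s=t$. Then $\preceq$ is reflexive and transitive and directs $S$ (any two elements of $S$ have a common $\preceq$-upper bound). Moreover, for $A\subseteq S$ the following are equivalent: (a) $d(A)>0$; (b) $d(A)=1$; (c) $A$ is cofinal in $S$ with respect to $\preceq$.
   Context: $\beta S$ is the set of ultrafilters on $S$ (points of $S$ identified with principal ultrafilters), a compact right topological semigroup with operation extending that of $S$ given by: $A\in pq$ iff $\{s\in S:s^{-1}A\in q\}\in p$, where $s^{-1}A=\{t:st\in A\}$. Under the hypothesis, $S$ satisfies the Strong F\o lner Condition: for every finite nonempty $H\subseteq S$ and $\epsilon>0$ there is a finite nonempty $K\subseteq S$ with $|K\setminus sK|<\epsilon|K|$ for all $s\in H$. $d(A)$ is the supremum of $\alpha\in[0,1]$ such that for every finite nonempty $H\subseteq S$ and $\epsilon>0$ there is a finite nonempty $K$ with $|K\setminus sK|<\epsilon|K|$ for all $s\in H$ and $|A\cap K|\ge\alpha|K|$. $A$ is cofinal if for every $s\in S$ there is $t\in A$ with $s\preceq t$. *)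

theory Defs
  imports Complex_Main
begin

text \<open>Ultrafilters are the proper filters \<open>F\<close> (in the library's sense) deciding every predicate.\<close>

typedef 'a ultrafilter =
  "{F :: 'a filter. F \<noteq> bot \<and> (\<forall>P. eventually P F \<or> eventually (\<lambda>x. \<not> P x) F)}"
  morphisms filter_of Abs_ultrafilter
proof
  show "principal {undefined} \<in> {F :: 'a filter. F \<noteq> bot \<and>
      (\<forall>P. eventually P F \<or> eventually (\<lambda>x. \<not> P x) F)}"
    by (auto simp: eventually_principal principal_eq_bot_iff)
qed

definition members :: "'a ultrafilter \<Rightarrow> 'a set set" where
  "members p = {A. \<forall>\<^sub>F x in filter_of p. x \<in> A}"

lemma ultrafilter_eqI:
  assumes "members p = members q"
  shows "p = q"
proof -
  have "eventually P (filter_of p) \<longleftrightarrow> eventually P (filter_of q)" for P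
    using arg_cong[OF assms, of "\<lambda>M. {x. P x} \<in> M"] by (simp add: members_def)
  then have "filter_of p = filter_of q" by (simp add: filter_eq_iff)
  then show ?thesis by (simp add: filter_of_inject)
qed

definition point :: "'a \<Rightarrow> 'a ultrafilter" where
  "point s = Abs_ultrafilter (principal {s})"

lemma members_point: "A \<in> members (point s) \<longleftrightarrow> s \<in> A"
proof -
  have "filter_of (point s) = principal {s}"
    unfolding point_def
    by (rule Abs_ultrafilter_inverse) (auto simp: eventually_principal principal_eq_bot_iff)
  then show ?thesis by (simp add: members_def eventually_principal)
qed

definition times_filter :: "'a::semigroup_mult filter \<Rightarrow> 'a filter \<Rightarrow> 'a filter" where
  "times_filter F G = Abs_filter (\<lambda>P. \<forall>\<^sub>F s in F. \<forall>\<^sub>F t in G. P (s * t))"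

lemma eventually_times_filter:
  "eventually P (times_filter F G) \<longleftrightarrow> (\<forall>\<^sub>F s in F. \<forall>\<^sub>F t in G. P (s * t))"
proof -
  have "is_filter (\<lambda>P. \<forall>\<^sub>F s in F. \<forall>\<^sub>F t in G. P (s * t))"
    by unfold_locales (auto simp: eventually_conj_iff elim!: eventually_mono)
  then show ?thesis by (simp add: times_filter_def eventually_Abs_filter)
qed

instantiation ultrafilter :: (semigroup_mult) semigroup_mult
begin

definition "p * q = Abs_ultrafilter (times_filter (filter_of p) (filter_of q))"

lemma filter_of_times: "filter_of (p * q) = times_filter (filter_of p) (filter_of q)"
proof -
  let ?F = "filter_of p" and ?G = "filter_of q"
  have F: "?F \<noteq> bot" "\<And>P. eventually P ?F \<or> eventually (\<lambda>x. \<not> P x) ?F"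
    and G: "?G \<noteq> bot" "\<And>P. eventually P ?G \<or> eventually (\<lambda>x. \<not> P x) ?G"
    using filter_of[of p] filter_of[of q] by auto
  have "times_filter ?F ?G \<noteq> bot"
    using F(1) G(1) by (simp add: trivial_limit_def eventually_times_filter)
  moreover have "eventually P (times_filter ?F ?G) \<or> eventually (\<lambda>x. \<not> P x) (times_filter ?F ?G)" for P
  proof -
    have "(\<forall>\<^sub>F s in ?F. \<forall>\<^sub>F t in ?G. P (s * t)) \<or> (\<forall>\<^sub>F s in ?F. \<not> (\<forall>\<^sub>F t in ?G. P (s * t)))"
      by (rule F(2))
    moreover have "(\<forall>\<^sub>F s in ?F. \<not> (\<forall>\<^sub>F t in ?G. P (s * t))) \<Longrightarrow>
        (\<forall>\<^sub>F s in ?F. \<forall>\<^sub>F t in ?G. \<not> P (s * t))"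
      by (erule eventually_mono) (use G(2) in blast)
    ultimately show ?thesis by (auto simp: eventually_times_filter)
  qed
  ultimately show ?thesis
    unfolding times_ultrafilter_def by (intro Abs_ultrafilter_inverse) auto
qed

instance
proof
  fix p q r :: "'a ultrafilter"
  show "p * q * r = p * (q * r)"
    unfolding filter_of_inject[symmetric] filter_of_times
    by (rule filter_eqI) (simp add: eventually_times_filter mult.assoc)
qed

end

lemma members_times:
  "A \<in> members (p * q) \<longleftrightarrow> {s. {t. s * t \<in> A} \<in> members q} \<in> members p"
  by (simp add: members_def filter_of_times eventually_times_filter)

lemma point_times: "point s * point t = point (s * t)"
  by (rule ultrafilter_eqI) (auto simp: set_eq_iff members_times members_point)

definition left_ideal :: "'a::semigroup_mult set \<Rightarrow> bool" where
  "left_ideal L \<longleftrightarrow> L \<noteq> {} \<and> (\<forall>s. \<forall>x\<in>L. s * x \<in> L)"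

definition minimal_left_ideal :: "'a::semigroup_mult set \<Rightarrow> bool" where
  "minimal_left_ideal L \<longleftrightarrow> left_ideal L \<and> (\<forall>M. left_ideal M \<and> M \<subseteq> L \<longrightarrow> M = L)"

definition prec :: "'a::semigroup_mult \<Rightarrow> 'a \<Rightarrow> bool" where
  "prec s t \<longleftrightarrow> s * t = t"

definition preceq :: "'a::semigroup_mult \<Rightarrow> 'a \<Rightarrow> bool" where
  "preceq s t \<longleftrightarrow> prec s t \<or> s = t"

text \<open>Unlike the library's \<open>cofinal\<close>, the bound may be the element itself.\<close>

definition preceq_cofinal :: "'a::semigroup_mult set \<Rightarrow> bool" where
  "preceq_cofinal A \<longleftrightarrow> (\<forall>s. \<exists>t\<in>A. preceq s t)"

text \<open>The set below contains \<open>0\<close>, so that its supremum is meaningful, precisely when the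
  semigroup satisfies the Strong Foelner Condition.\<close>

definition folner_density :: "'a::semigroup_mult set \<Rightarrow> real" where
  "folner_density A = Sup {\<alpha> \<in> {0..1}. \<forall>H \<epsilon>. finite H \<and> H \<noteq> {} \<and> \<epsilon> > 0 \<longrightarrow>
     (\<exists>K. finite K \<and> K \<noteq> {} \<and>
       (\<forall>s\<in>H. real (card (K - (\<lambda>k. s * k) ` K)) < \<epsilon> * real (card K)) \<and>
       real (card (A \<inter> K)) \<ge> \<alpha> * real (card K))}"

end

theory Submission
  imports Defs
begin

text \<open>A proper filter that is invariant under left translation and minimal as such corresponds to a
  closed minimal left ideal of \<open>\<beta>S\<close>. By hypothesis this ideal is a singleton \<open>{p}\<close>, so
  \<open>s p = p\<close> for all \<open>s\<close>. A self-map fixing an ultrafilter fixes almost every point, hence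
  \<open>{t. s t = t}\<close> belongs to \<open>p\<close> for all \<open>s\<close>, and finitely many elements have a common
  \<open>t\<close> with \<open>s t = t\<close>. The singleton \<open>{t}\<close> is then a Foelner set. Conversely, if \<open>s u = u\<close>
  then every element of \<open>K \<inter> u K\<close> is fixed by \<open>s\<close>, so a set without points above \<open>s\<close>
  meets \<open>K\<close> only in \<open>K - u K\<close>.\<close>

section \<open>Minimal filters and ultrafilters\<close>

text \<open>Zorn's lemma for the reversed order. A nonempty chain is a filter base, so whatever
  holds eventually in its infimum already does so in a member; hence the infimum is proper. With
  trivial \<open>Q\<close> this yields ultrafilters, with translation invariance minimal left
  ideals.\<close>

lemma minimal_filter_exists:
  fixes Q :: "'a filter \<Rightarrow> bool"
  assumes "F0 \<noteq> bot" "Q F0"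
    and Inf_closed: "\<And>C. C \<noteq> {} \<Longrightarrow> \<forall>F\<in>C. \<forall>G\<in>C. F \<le> G \<or> G \<le> F \<Longrightarrow> \<forall>F\<in>C. Q F \<Longrightarrow> Q (Inf C)"
  obtains F where "F \<le> F0" "F \<noteq> bot" "Q F" "\<And>G. G \<le> F \<Longrightarrow> G \<noteq> bot \<Longrightarrow> Q G \<Longrightarrow> G = F"
proof -
  let ?A = "{F. F \<le> F0 \<and> F \<noteq> bot \<and> Q F}"
  have "\<exists>m\<in>?A. \<forall>a\<in>?A. m \<ge> a \<longrightarrow> a = m"
  proof (rule predicate_Zorn)
    show "partial_order_on ?A (relation_of (\<ge>) ?A)"
      by (rule partial_order_on_relation_ofI) auto
    fix C assume "C \<in> Chains (relation_of (\<ge>) ?A)"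
    then have C: "C \<subseteq> ?A" "\<forall>F\<in>C. \<forall>G\<in>C. F \<le> G \<or> G \<le> F"
      by (auto simp: Chains_def relation_of_def)
    show "\<exists>u\<in>?A. \<forall>a\<in>C. a \<ge> u"
    proof (cases "C = {}")
      case True
      then show ?thesis using assms(1,2) by auto
    next
      case False
      have "eventually P (Inf C) \<longleftrightarrow> (\<exists>F\<in>C. eventually P F)" for P
        by (rule eventually_Inf_base) (use False C(2) in \<open>auto intro: exI\<close>)
      then have "Inf C \<noteq> bot"
        using C(1) by (auto simp: trivial_limit_def)
      moreover have "Inf C \<le> F0"
        using False C(1) by (blast intro: Inf_lower2)
      moreover have "Q (Inf C)"
        using False C by (intro Inf_closed) auto
      ultimately show ?thesis by (auto intro!: bexI[of _ "Inf C"] Inf_lower)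
    qed
  qed
  then obtain F where "F \<in> ?A" "\<forall>G\<in>?A. G \<le> F \<longrightarrow> G = F" by auto
  then show ?thesis
    by (intro that[of F]) (auto dest: order_trans)
qed

lemma filter_of_neq_bot: "filter_of p \<noteq> bot"
  using filter_of[of p] by simp

lemma eventually_not_iff:
  "eventually (\<lambda>x. \<not> P x) (filter_of p) \<longleftrightarrow> \<not> eventually P (filter_of p)"
proof
  assume "eventually (\<lambda>x. \<not> P x) (filter_of p)"
  show "\<not> eventually P (filter_of p)"
  proof
    assume "eventually P (filter_of p)"
    with \<open>eventually (\<lambda>x. \<not> P x) (filter_of p)\<close> have "eventually (\<lambda>x. False) (filter_of p)"
      by eventually_elim simp
    then show False using filter_of_neq_bot[of p] by (simp add: trivial_limit_def)
  qed
next
  assume "\<not> eventually P (filter_of p)"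
  then show "eventually (\<lambda>x. \<not> P x) (filter_of p)"
    using filter_of[of p] by auto
qed

lemma filter_of_le_imp_eq:
  assumes "filter_of p \<le> filter_of q"
  shows "p = q"
proof -
  have "eventually P (filter_of p) \<longleftrightarrow> eventually P (filter_of q)" for P
    using assms eventually_not_iff[of P p] eventually_not_iff[of P q] by (auto simp: le_filter_def)
  then show ?thesis by (simp add: filter_of_inject[symmetric] filter_eq_iff)
qed

lemma ultrafilter_below_exists:
  assumes "F0 \<noteq> bot"
  obtains p where "filter_of p \<le> F0"
proof -
  obtain F where F: "F \<le> F0" "F \<noteq> bot" "\<And>G. G \<le> F \<Longrightarrow> G \<noteq> bot \<Longrightarrow> G = F"
    using minimal_filter_exists[of F0 "\<lambda>_. True"] assms by auto
  have "eventually P F" if "\<not> eventually (\<lambda>x. \<not> P x) F" for P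
  proof -
    \<comment> \<open>Restricting a minimal proper filter to a set that meets it properly cannot
      shrink it, so the set already belongs to it.\<close>
    have "inf F (principal {x. P x}) \<noteq> bot"
      using that by (simp add: trivial_limit_def eventually_inf_principal)
    then have "inf F (principal {x. P x}) = F" by (intro F(3)) auto
    then show ?thesis using eventually_inf_principal[of P F "{x. P x}"] by simp
  qed
  then have "F \<in> {F. F \<noteq> bot \<and> (\<forall>P. eventually P F \<or> eventually (\<lambda>x. \<not> P x) F)}"
    using F(2) by auto
  then have "filter_of (Abs_ultrafilter F) = F" by (rule Abs_ultrafilter_inverse)
  with F(1) show ?thesis by (intro that[of "Abs_ultrafilter F"]) simp
qed

section \<open>Minimal left ideals\<close>

text \<open>For a proper \<open>F\<close>, this makes the closed set of ultrafilters below
  \<open>F\<close> a left ideal of \<beta>S. Translations by points of S suffice: a condition valid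
  for all \<open>s\<close> is valid almost everywhere for any filter of left factors.\<close>

definition translation_invariant :: "'a::semigroup_mult filter \<Rightarrow> bool" where
  "translation_invariant F \<longleftrightarrow> (\<forall>s P. eventually P F \<longrightarrow> (\<forall>\<^sub>F t in F. P (s * t)))"

lemma times_filter_translation_invariant:
  assumes "translation_invariant F" "G \<le> F"
  shows "times_filter H G \<le> F"
  unfolding le_filter_def
proof (intro allI impI)
  fix P assume "eventually P F"
  then have "\<forall>\<^sub>F t in G. P (s * t)" for s
    using assms by (auto simp: translation_invariant_def le_filter_def)
  then show "eventually P (times_filter H G)"
    by (simp add: eventually_times_filter)
qed

text \<open>The set of solutions is a nonempty intersection of closed sets: this replaces the continuity of
  \<open>q \<mapsto> q x\<close> and the compactness of \<open>\<beta>S\<close>.\<close>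

lemma times_filter_top_solve:
  assumes "filter_of p \<le> times_filter top (filter_of x)"
  obtains q where "q * x = p"
proof -
  \<comment> \<open>\<open>R P s\<close> means that \<open>P\<close> belongs to
    \<open>point s * x\<close>. An ultrafilter \<open>q\<close> below the filter \<open>H\<close>
    generated by these sets has every \<open>P\<close> of \<open>p\<close> in
    \<open>q * x\<close>.\<close>
  define R where "R P s \<longleftrightarrow> (\<forall>\<^sub>F t in filter_of x. P (s * t))" for P s
  define H where "H = Abs_filter (\<lambda>Q. \<exists>P. eventually P (filter_of p) \<and> (\<forall>s. R P s \<longrightarrow> Q s))"
  have "is_filter (\<lambda>Q. \<exists>P. eventually P (filter_of p) \<and> (\<forall>s. R P s \<longrightarrow> Q s))"
  proof
    show "\<exists>P. eventually P (filter_of p) \<and> (\<forall>s. R P s \<longrightarrow> True)"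
      by (auto intro: exI[of _ "\<lambda>_. True"])
  next
    fix Q Q'
    assume "\<exists>P. eventually P (filter_of p) \<and> (\<forall>s. R P s \<longrightarrow> Q s)"
      and "\<exists>P. eventually P (filter_of p) \<and> (\<forall>s. R P s \<longrightarrow> Q' s)"
    then obtain P P' where "eventually P (filter_of p)" "\<forall>s. R P s \<longrightarrow> Q s"
      "eventually P' (filter_of p)" "\<forall>s. R P' s \<longrightarrow> Q' s" by auto
    then show "\<exists>P. eventually P (filter_of p) \<and> (\<forall>s. R P s \<longrightarrow> Q s \<and> Q' s)"
      by (intro exI[of _ "\<lambda>t. P t \<and> P' t"]) (auto simp: R_def eventually_conj_iff)
  qed auto
  then have H: "eventually Q H \<longleftrightarrow> (\<exists>P. eventually P (filter_of p) \<and> (\<forall>s. R P s \<longrightarrow> Q s))" for Q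
    unfolding H_def by (rule eventually_Abs_filter)
  have "\<exists>s. R P s" if "eventually P (filter_of p)" for P
  proof (rule ccontr)
    assume "\<nexists>s. R P s"
    then have "eventually (\<lambda>t. \<not> P t) (times_filter top (filter_of x))"
      by (simp add: eventually_times_filter R_def eventually_not_iff)
    with assms have "eventually (\<lambda>t. \<not> P t) (filter_of p)" by (auto simp: le_filter_def)
    with that show False by (simp add: eventually_not_iff)
  qed
  then have "H \<noteq> bot" by (auto simp: trivial_limit_def H)
  then obtain q where q: "filter_of q \<le> H" by (rule ultrafilter_below_exists)
  have "filter_of (q * x) \<le> filter_of p"
    unfolding filter_of_times le_filter_def
  proof (intro allI impI)
    fix P assume "eventually P (filter_of p)"
    then have "eventually (R P) H" by (auto simp: H)
    with q have "eventually (R P) (filter_of q)" by (auto simp: le_filter_def)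
    then show "eventually P (times_filter (filter_of q) (filter_of x))"
      unfolding eventually_times_filter R_def[symmetric] .
  qed
  then show ?thesis by (intro that filter_of_le_imp_eq)
qed

lemma minimal_left_ideal_ultrafilter_exists:
  obtains L :: "'a::semigroup_mult ultrafilter set" where "minimal_left_ideal L"
proof -
  obtain F :: "'a filter" where F: "F \<noteq> bot" "translation_invariant F"
    and F_min: "\<And>G. G \<le> F \<Longrightarrow> G \<noteq> bot \<Longrightarrow> translation_invariant G \<Longrightarrow> G = F"
  proof (rule minimal_filter_exists[of top translation_invariant])
    show "top \<noteq> (bot :: 'a filter)" by (simp add: trivial_limit_def)
    show "translation_invariant (top :: 'a filter)" by (simp add: translation_invariant_def)
    fix C :: "'a filter set"
    assume C: "C \<noteq> {}" "\<forall>F\<in>C. \<forall>G\<in>C. F \<le> G \<or> G \<le> F" "\<forall>F\<in>C. translation_invariant F"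
    have "eventually P (Inf C) \<longleftrightarrow> (\<exists>F\<in>C. eventually P F)" for P
      by (rule eventually_Inf_base) (use C(1,2) in auto)
    then show "translation_invariant (Inf C)"
      using C(3) by (simp add: translation_invariant_def) blast
  qed auto
  define L where "L = {p. filter_of p \<le> F}"
  have "left_ideal L"
    unfolding left_ideal_def
  proof
    show "L \<noteq> {}" using ultrafilter_below_exists[OF F(1)] by (auto simp: L_def)
    show "\<forall>q. \<forall>x\<in>L. q * x \<in> L"
      using times_filter_translation_invariant[OF F(2)] by (auto simp: L_def filter_of_times)
  qed
  moreover have "M = L" if M: "left_ideal M" "M \<subseteq> L" for M
  proof -
    obtain x where x: "x \<in> M" using M(1) by (auto simp: left_ideal_def)
    \<comment> \<open>The filter of the closed left ideal \<beta>S \<open>x\<close>, which lies in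
      \<open>M\<close>. Minimality of \<open>F\<close> forces it to be all of
      \<open>L\<close>.\<close>
    let ?G = "times_filter top (filter_of x)"
    have "?G = F"
    proof (rule F_min)
      show "?G \<le> F"
        using x M(2) by (intro times_filter_translation_invariant F(2)) (auto simp: L_def)
      show "?G \<noteq> bot"
        using filter_of_neq_bot[of x] by (simp add: trivial_limit_def eventually_times_filter)
      show "translation_invariant ?G"
        by (simp add: translation_invariant_def eventually_times_filter mult.assoc[symmetric])
    qed
    have "p \<in> M" if "p \<in> L" for p
    proof -
      have "filter_of p \<le> ?G" using that \<open>?G = F\<close> by (simp add: L_def)
      then obtain q where "q * x = p" by (rule times_filter_top_solve)
      with x M(1) show ?thesis by (auto simp: left_ideal_def)
    qed
    with M(2) show ?thesis by blast
  qed
  ultimately show ?thesis by (intro that[of L]) (auto simp: minimal_left_ideal_def)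
qed

section \<open>Fixed points\<close>

text \<open>Either \<open>Q\<close> or its negation holds almost everywhere, and by invariance the
  same one holds at \<open>f t\<close> too.\<close>

lemma not_eventually_alternating:
  assumes inv: "\<And>P. eventually P (filter_of p) \<Longrightarrow> \<forall>\<^sub>F t in filter_of p. P (f t)"
  shows "\<not> (\<forall>\<^sub>F t in filter_of p. Q (f t) \<longleftrightarrow> \<not> Q t)"
proof
  assume alt: "\<forall>\<^sub>F t in filter_of p. Q (f t) \<longleftrightarrow> \<not> Q t"
  consider "eventually Q (filter_of p)" | "eventually (\<lambda>t. \<not> Q t) (filter_of p)"
    by (auto simp: eventually_not_iff)
  then have "\<forall>\<^sub>F t in filter_of p. False"
  proof cases
    case 1
    from alt 1 inv[OF 1] show ?thesis by eventually_elim simp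
  next
    case 2
    from alt 2 inv[OF 2] show ?thesis by eventually_elim simp
  qed
  then show False using filter_of_neq_bot[of p] by (simp add: trivial_limit_def)
qed

text \<open>Choose a root \<open>r t\<close> in each component of the functional graph of \<open>f\<close>. The number \<open>m t\<close> of
  steps from \<open>t\<close> to the forward orbit of the root drops by one along \<open>f\<close> as long as it is positive,
  so almost every point lies on that orbit. There its index \<open>n t\<close> grows by one along \<open>f\<close>, except
  where the orbit closes up to a cycle. Closing happens at most once per component, hence almost nowhere
  by invariance; both alternations are excluded by parity.\<close>

lemma eventually_fixed_point:
  assumes inv: "\<And>P. eventually P (filter_of p) \<Longrightarrow> \<forall>\<^sub>F t in filter_of p. P (f t)"
  shows "\<forall>\<^sub>F t in filter_of p. f t = t"
proof (rule ccontr)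
  assume "\<not> (\<forall>\<^sub>F t in filter_of p. f t = t)"
  then have moved: "\<forall>\<^sub>F t in filter_of p. f t \<noteq> t" by (simp add: eventually_not_iff)
  define r where "r t = (SOME u. \<exists>m n. (f ^^ m) t = (f ^^ n) u)" for t
  define m where "m t = (LEAST m. \<exists>n. (f ^^ m) t = (f ^^ n) (r t))" for t
  define n where "n t = (LEAST n. (f ^^ n) (r t) = t)" for t
  have shift: "(f ^^ k) (f t) = (f ^^ Suc k) t" for k t
    by (simp add: funpow_swap1)
  have "(\<exists>m n. (f ^^ m) (f t) = (f ^^ n) u) \<longleftrightarrow> (\<exists>m n. (f ^^ m) t = (f ^^ n) u)" for t u
  proof
    assume "\<exists>m n. (f ^^ m) t = (f ^^ n) u"
    then obtain m n where "(f ^^ m) t = (f ^^ n) u" by blast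
    then have "(f ^^ m) (f t) = (f ^^ Suc n) u" unfolding shift by simp
    then show "\<exists>m n. (f ^^ m) (f t) = (f ^^ n) u" by blast
  qed (metis shift)
  \<comment> \<open>Forward orbits from \<open>t\<close> and from \<open>f t\<close> meet the same
    orbits, so \<open>SOME\<close> selects from the same set.\<close>
  then have r_f: "r (f t) = r t" for t by (simp add: r_def)
  have ex: "\<exists>m n. (f ^^ m) t = (f ^^ n) (r t)" for t
    unfolding r_def by (rule someI[of _ t]) blast
  have m_prop: "\<exists>n. (f ^^ m t) t = (f ^^ n) (r t)" for t
    unfolding m_def by (rule LeastI_ex) (rule ex)
  have m_f: "m t = Suc (m (f t))" if nz: "m t \<noteq> 0" for t
  proof (rule antisym)
    show "m t \<le> Suc (m (f t))"
      using m_prop[of "f t"] unfolding m_def[of t] by (intro Least_le) (simp only: shift r_f)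
    obtain k where k: "m t = Suc k" using nz by (cases "m t") auto
    have "m (f t) \<le> k"
      using m_prop[of t] unfolding m_def[of "f t"] by (intro Least_le) (simp only: shift r_f k)
    with k show "Suc (m (f t)) \<le> m t" by simp
  qed
  have "\<not> (\<forall>\<^sub>F t in filter_of p. m t \<noteq> 0)"
  proof
    assume "\<forall>\<^sub>F t in filter_of p. m t \<noteq> 0"
    then have "\<forall>\<^sub>F t in filter_of p. even (m (f t)) \<longleftrightarrow> \<not> even (m t)"
      by eventually_elim (metis m_f even_Suc)
    then show False using not_eventually_alternating[of p f "\<lambda>t. even (m t)", OF inv] by blast
  qed
  then have m0: "\<forall>\<^sub>F t in filter_of p. m t = 0" by (simp only: eventually_not_iff not_not)
  have n_prop: "(f ^^ n t) (r t) = t" if "m t = 0" for t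
    unfolding n_def by (rule LeastI_ex) (use m_prop[of t] that in \<open>auto intro: sym\<close>)
  have n_le: "n t \<le> k" if "(f ^^ k) (r t) = t" for t k
    unfolding n_def by (rule Least_le) (rule that)
  have n_f: "n (f t) \<le> Suc (n t)" if "m t = 0" for t
    by (rule n_le) (simp add: r_f n_prop that)
  define closing where "closing t \<longleftrightarrow> n (f t) \<le> n t" for t
  \<comment> \<open>Since \<open>f t\<close> differs from \<open>t\<close>, closing gives
    \<open>k < n t\<close>. If \<open>f t\<close> closed as well, position \<open>k + 1\<close> of
    the orbit would coincide with position \<open>j \<le> k\<close>, and this shortcut would reach
    \<open>t\<close> in fewer than \<open>n t\<close> steps.\<close>
  have no_two: "\<not> closing (f t)" if t: "m t = 0" "m (f t) = 0" "m (f (f t)) = 0" "f t \<noteq> t" "closing t" for t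
  proof
    assume "closing (f t)"
    define k j where "k = n (f t)" and "j = n (f (f t))"
    have "k \<le> n t" "j \<le> k"
      using t(5) \<open>closing (f t)\<close> by (auto simp: closing_def k_def j_def)
    have k: "(f ^^ k) (r t) = f t"
      using n_prop[OF t(2)] by (simp add: k_def r_f)
    have j: "(f ^^ j) (r t) = f (f t)"
      using n_prop[OF t(3)] by (simp add: j_def r_f)
    have "k \<noteq> n t" using k n_prop[OF t(1)] t(4) by auto
    with \<open>k \<le> n t\<close> obtain d where d: "n t = d + Suc k"
      by (metis le_neq_implies_less less_natE add.commute add_Suc_right)
    have "(f ^^ d) ((f ^^ Suc k) (r t)) = t"
      using n_prop[OF t(1)] by (simp only: d funpow_add o_apply)
    moreover have "(f ^^ Suc k) (r t) = (f ^^ j) (r t)" by (simp add: k j)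
    ultimately have "(f ^^ (d + j)) (r t) = t" by (simp only: funpow_add o_apply)
    then have "n t \<le> d + j" by (rule n_le)
    with d \<open>j \<le> k\<close> show False by simp
  qed
  have not_closing: "\<forall>\<^sub>F t in filter_of p. \<not> closing t"
  proof (rule ccontr)
    assume "\<not> ?thesis"
    then have c: "eventually closing (filter_of p)" by (simp add: eventually_not_iff)
    from c inv[OF c] m0 inv[OF m0] inv[OF inv[OF m0]] moved have "\<forall>\<^sub>F t in filter_of p. False"
      by eventually_elim (use no_two in blast)
    then show False using filter_of_neq_bot[of p] by (simp add: trivial_limit_def)
  qed
  from not_closing m0 have "\<forall>\<^sub>F t in filter_of p. even (n (f t)) \<longleftrightarrow> \<not> even (n t)"
  proof eventually_elim
    case (elim t)
    then have "n (f t) = Suc (n t)" using n_f[of t] by (simp add: closing_def)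
    then show ?case by simp
  qed
  then show False using not_eventually_alternating[of p f "\<lambda>t. even (n t)", OF inv] by blast
qed

section \<open>The order and the density\<close>

lemma prec_trans:
  fixes s t u :: "'a::semigroup_mult"
  assumes "prec s t" "prec t u"
  shows "prec s u"
  using assms unfolding prec_def by (metis mult.assoc)

lemma finite_common_fixed_point:
  assumes min: "\<forall>L :: 'a::semigroup_mult ultrafilter set. minimal_left_ideal L \<longrightarrow> is_singleton L"
    and "finite (H :: 'a set)"
  shows "\<exists>t. \<forall>s\<in>H. s * t = t"
proof -
  obtain L :: "'a ultrafilter set" where L: "minimal_left_ideal L"
    by (rule minimal_left_ideal_ultrafilter_exists)
  with min obtain p where "L = {p}" by (auto simp: is_singleton_def)
  with L have absorb: "q * p = p" for q
    by (auto simp: minimal_left_ideal_def left_ideal_def)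
  have "\<forall>\<^sub>F t in filter_of p. s * t = t" for s
  proof (rule eventually_fixed_point)
    fix P assume "eventually P (filter_of p)"
    \<comment> \<open>Invariance under translation by \<open>s\<close> is the equation
      \<open>point s * p = p\<close> read on members.\<close>
    then have "{t. P t} \<in> members (point s * p)" by (simp add: absorb members_def)
    then show "\<forall>\<^sub>F t in filter_of p. P (s * t)"
      by (simp add: members_times members_point) (simp add: members_def)
  qed
  then have "\<forall>\<^sub>F t in filter_of p. \<forall>s\<in>H. s * t = t"
    using \<open>finite H\<close> by (simp add: eventually_ball_finite)
  then show ?thesis
    by (rule eventually_happens'[OF filter_of_neq_bot])
qed

definition folner_bound :: "'a::semigroup_mult set \<Rightarrow> real \<Rightarrow> bool" where
  "folner_bound A \<alpha> \<longleftrightarrow> (\<forall>H \<epsilon>. finite H \<and> H \<noteq> {} \<and> \<epsilon> > 0 \<longrightarrow>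
     (\<exists>K. finite K \<and> K \<noteq> {} \<and>
       (\<forall>s\<in>H. real (card (K - (\<lambda>k. s * k) ` K)) < \<epsilon> * real (card K)) \<and>
       real (card (A \<inter> K)) \<ge> \<alpha> * real (card K)))"

lemma folner_density_eq: "folner_density A = Sup {\<alpha> \<in> {0..1}. folner_bound A \<alpha>}"
  by (simp add: folner_density_def folner_bound_def)

text \<open>For \<open>K = {t}\<close> with \<open>t\<close> fixed by all of \<open>H\<close>, the
  difference \<open>K - s K\<close> is empty, so every \<epsilon> works. The alternative
  \<open>\<alpha> \<le> 0\<close> admits the bound 0 for arbitrary \<open>A\<close>.\<close>

lemma folner_bound_singleton:
  assumes "\<And>H. finite H \<Longrightarrow> \<exists>t. (\<forall>s\<in>H. s * t = t) \<and> (t \<in> A \<or> \<alpha> \<le> 0)" "\<alpha> \<le> 1"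
  shows "folner_bound A \<alpha>"
  unfolding folner_bound_def
proof (intro allI impI)
  fix H :: "'a set" and \<epsilon> :: real
  assume H: "finite H \<and> H \<noteq> {} \<and> \<epsilon> > 0"
  then obtain t where "\<forall>s\<in>H. s * t = t" "t \<in> A \<or> \<alpha> \<le> 0" using assms(1) by blast
  with H assms(2) show "\<exists>K. finite K \<and> K \<noteq> {} \<and>
       (\<forall>s\<in>H. real (card (K - (\<lambda>k. s * k) ` K)) < \<epsilon> * real (card K)) \<and>
       real (card (A \<inter> K)) \<ge> \<alpha> * real (card K)"
    by (intro exI[of _ "{t}"]) (cases "t \<in> A"; auto)
qed

lemma folner_density_eq_1:
  assumes zero: "\<And>H :: 'a::semigroup_mult set. finite H \<Longrightarrow> \<exists>t. \<forall>s\<in>H. s * t = t"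
    and "preceq_cofinal (A :: 'a set)"
  shows "folner_density A = 1"
proof -
  have "folner_bound A 1"
  proof (rule folner_bound_singleton)
    fix H :: "'a set" assume "finite H"
    then obtain u where u: "\<forall>s\<in>H. s * u = u" using zero by blast
    \<comment> \<open>Any element above the common fixed point \<open>u\<close> is again fixed by
      all of \<open>H\<close>, so the singleton can be moved into \<open>A\<close>.\<close>
    obtain t where "t \<in> A" "preceq u t"
      using \<open>preceq_cofinal A\<close> by (auto simp: preceq_cofinal_def)
    moreover have "s * t = t" if "s \<in> H" for s
      using \<open>preceq u t\<close> u that prec_trans[of s u t] by (auto simp: preceq_def prec_def)
    ultimately show "\<exists>t. (\<forall>s\<in>H. s * t = t) \<and> (t \<in> A \<or> (1::real) \<le> 0)" by blast
  qed simp
  then show ?thesis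
    unfolding folner_density_eq by (intro cSup_eq_maximum) auto
qed

lemma preceq_cofinal_if_folner_density_pos:
  assumes zero: "\<And>H :: 'a::semigroup_mult set. finite H \<Longrightarrow> \<exists>t. \<forall>s\<in>H. s * t = t"
    and pos: "folner_density (A :: 'a set) > 0"
  shows "preceq_cofinal A"
proof (rule ccontr)
  assume "\<not> preceq_cofinal A"
  then obtain s where s: "\<forall>t\<in>A. s * t \<noteq> t"
    by (auto simp: preceq_cofinal_def preceq_def prec_def)
  obtain u where u: "s * u = u" using zero[of "{s}"] by auto
  \<comment> \<open>Makes the set under the supremum nonempty, so that a positive supremum yields a
    positive bound.\<close>
  have "folner_bound A 0"
    using zero by (intro folner_bound_singleton) auto
  then have "{\<alpha> \<in> {0..1}. folner_bound A \<alpha>} \<noteq> {}" by (auto intro!: exI[of _ 0])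
  from less_cSupE[OF pos[unfolded folner_density_eq] this]
  obtain \<alpha> where \<alpha>: "\<alpha> > 0" "folner_bound A \<alpha>" by auto
  \<comment> \<open>Taking \<epsilon> equal to \<alpha> sets the two estimates directly against each
    other.\<close>
  then obtain K where K: "finite K"
    "real (card (K - (\<lambda>k. u * k) ` K)) < \<alpha> * real (card K)"
    "real (card (A \<inter> K)) \<ge> \<alpha> * real (card K)"
    unfolding folner_bound_def by (auto dest!: spec[of _ "{u}"] spec[of _ \<alpha>])
  \<comment> \<open>By associativity \<open>s\<close> fixes \<open>u * k\<close>, and
    \<open>A\<close> contains no fixed point of \<open>s\<close>.\<close>
  have "u * k \<notin> A" for k
    using s u by (metis mult.assoc)
  then have "A \<inter> K \<subseteq> K - (\<lambda>k. u * k) ` K" by auto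
  then have "card (A \<inter> K) \<le> card (K - (\<lambda>k. u * k) ` K)"
    using K(1) by (intro card_mono) auto
  with K(2,3) show False by linarith
qed

theorem theorem4p7:
  assumes "\<forall>L :: 'a::semigroup_mult ultrafilter set. minimal_left_ideal L \<longrightarrow> is_singleton L"
  shows "reflp (preceq :: 'a \<Rightarrow> 'a \<Rightarrow> bool) \<and> transp (preceq :: 'a \<Rightarrow> 'a \<Rightarrow> bool) \<and>
    (\<forall>s t :: 'a. \<exists>u. preceq s u \<and> preceq t u) \<and>
    (\<forall>A :: 'a set.
      (folner_density A > 0 \<longleftrightarrow> folner_density A = 1) \<and>
      (folner_density A = 1 \<longleftrightarrow> preceq_cofinal A))"
proof (intro conjI allI)
  have zero: "\<exists>t. \<forall>s\<in>H. s * t = t" if "finite H" for H :: "'a set"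
    by (rule finite_common_fixed_point[OF assms that])
  show "reflp (preceq :: 'a \<Rightarrow> 'a \<Rightarrow> bool)"
    by (simp add: reflp_def preceq_def)
  show "transp (preceq :: 'a \<Rightarrow> 'a \<Rightarrow> bool)"
    by (auto simp: transp_def preceq_def dest: prec_trans)
  show "\<exists>u. preceq s u \<and> preceq t u" for s t :: 'a
    using zero[of "{s, t}"] by (auto simp: preceq_def prec_def)
  fix A :: "'a set"
  note cofinal = preceq_cofinal_if_folner_density_pos[OF zero, of A]
    and density = folner_density_eq_1[OF zero, of A]
  show "folner_density A > 0 \<longleftrightarrow> folner_density A = 1"
    using cofinal density by auto
  show "folner_density A = 1 \<longleftrightarrow> preceq_cofinal A"
    using cofinal density by auto
qed

end
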